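(* Let $K$ be a field of characteristic zero, let $\mathbf{T}$ be a neutral Tannakian category over $K$, let $A$ and $B$ be nonzero objects of $\mathbf{T}$, and let $$0\to B\to E\to A\to 0$$ be a short exact sequence in $\mathbf{T}$. Let $\mathfrak{u}(E)\subset Hom(A,B)$ be the Lie algebra of the kernel of the natural homomorphism from the Tannakian group of $E$ to the Tannakian group of $A\oplus B$, considered as a subobject of the internal Hom object $Hom(A,B)$. Assume that $\mathfrak{u}(E)=Hom(A,B)$. Then the image of the algebra homomorphism $$\Omega: End_{\mathbf{T}}(E;B)\to End_{\mathbf{T}}(B)\times End_{\mathbf{T}}(A),\qquad \phi\mapsto(\phi_B,\phi_A),$$ is equal to the diagonal copy of $K$, that is, to $\{(a\cdot Id_B,\,a\cdot Id_A): a\in K\}$.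
   Context: $End_{\mathbf{T}}(X)$ is the endomorphism algebra of an object $X$ of $\mathbf{T}$. For a subobject $Y\subset X$, $End_{\mathbf{T}}(X;Y)$ is the subalgebra of those endomorphisms of $X$ that map $Y$ to $Y$. Given the exact sequence $0\to B\to E\to A\to 0$ and $\phi\in End_{\mathbf{T}}(E;B)$, $\phi_B$ is the restriction of $\phi$ to $B$ and $\phi_A$ is the endomorphism of $A\cong E/B$ induced by $\phi$. Definition of $\mathfrak{u}(E)$: Fix a fiber functor and identify $\mathbf{T}$ with the category of finite dimensional algebraic representations of an affine group scheme $\mathcal{G}$ over $K$; use the same symbol for an object and its underlying vector space. For an object $X$, the Tannakian group $\mathcal{G}(X)$ of $X$ is the image of $\mathcal{G}$ in $GL(X)$. Let $\mathcal{U}(E)$ be the kernel of the natural surjection $\mathcal{G}(E)\to\mathcal{G}(A\oplus B)$. Choosing a linear section of $E\to A$ to identify $E=B\oplus A$ as vector spaces, $\mathcal{U}(E)$ is a subgroup of the abelian unipotent group $\left\{\begin{pmatrix} Id_B & f\\ 0& Id_A\end{pmatrix}: f\in Hom(A,B)\right\}$, and this embedding does not depend on the section. The Lie algebra $\mathfrak{u}(E)$ of $\mathcal{U}(E)$ is thereby identified with a subspace of $Hom(A,B)$ ($f$ corresponding to the matrix above under the exponential map). It is stable under $\mathcal{G}$, hence is a subobject of the internal Hom object $Hom(A,B)$ in $\mathbf{T}$. *)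

theory Defs
  imports "Jordan_Normal_Form.Determinant"
begin

section \<open>Abelian tensor categories over a field\<close>

text \<open>
  A small category with a \<open>K\<close>-linear structure and a tensor product, given by sets of objects and
  arrows. Every arrow knows its domain and codomain, so that the operations on arrows need no object
  arguments; their values outside the intended domain are irrelevant. \<open>Zero X Y\<close> is the zero arrow
  from \<open>X\<close> to \<open>Y\<close>. The constraints are \<open>Assoc X Y Z : (X \<otimes> Y) \<otimes> Z \<rightarrow> X \<otimes> (Y \<otimes> Z)\<close>,
  \<open>LUnit X : 1 \<otimes> X \<rightarrow> X\<close>, \<open>RUnit X : X \<otimes> 1 \<rightarrow> X\<close> and \<open>Braid X Y : X \<otimes> Y \<rightarrow> Y \<otimes> X\<close>.
\<close>

record ('o, 'a, 'k) tensor_cat =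
  Ob :: "'o set"
  Arr :: "'a set"
  Dom :: "'a \<Rightarrow> 'o"
  Cod :: "'a \<Rightarrow> 'o"
  Id :: "'o \<Rightarrow> 'a"
  Comp :: "'a \<Rightarrow> 'a \<Rightarrow> 'a"  (infixr "\<cdot>\<index>" 75)
  Zero :: "'o \<Rightarrow> 'o \<Rightarrow> 'a"
  Add :: "'a \<Rightarrow> 'a \<Rightarrow> 'a"  (infixl "\<boxplus>\<index>" 65)
  Scale :: "'k \<Rightarrow> 'a \<Rightarrow> 'a"
  TensO :: "'o \<Rightarrow> 'o \<Rightarrow> 'o"  (infixr "\<odot>\<index>" 80)
  TensA :: "'a \<Rightarrow> 'a \<Rightarrow> 'a"  (infixr "\<star>\<index>" 80)
  UnitO :: "'o"
  Assoc :: "'o \<Rightarrow> 'o \<Rightarrow> 'o \<Rightarrow> 'a"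
  LUnit :: "'o \<Rightarrow> 'a"
  RUnit :: "'o \<Rightarrow> 'a"
  Braid :: "'o \<Rightarrow> 'o \<Rightarrow> 'a"

definition Mor :: "('o, 'a, 'k) tensor_cat \<Rightarrow> 'o \<Rightarrow> 'o \<Rightarrow> 'a set" where
  "Mor T X Y = {f \<in> Arr T. Dom T f = X \<and> Cod T f = Y}"

locale cat =
  fixes T :: "('o, 'a, 'k::field) tensor_cat" (structure)
  assumes Dom_Ob: "f \<in> Arr T \<Longrightarrow> Dom T f \<in> Ob T"
    and Cod_Ob: "f \<in> Arr T \<Longrightarrow> Cod T f \<in> Ob T"
    and Id_Mor: "X \<in> Ob T \<Longrightarrow> Id T X \<in> Mor T X X"
    and Comp_Mor: "f \<in> Mor T X Y \<Longrightarrow> g \<in> Mor T Y Z \<Longrightarrow> g \<cdot> f \<in> Mor T X Z"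
    and Comp_Id: "f \<in> Mor T X Y \<Longrightarrow> f \<cdot> Id T X = f"
    and Id_Comp: "f \<in> Mor T X Y \<Longrightarrow> Id T Y \<cdot> f = f"
    and Comp_assoc: "f \<in> Mor T W X \<Longrightarrow> g \<in> Mor T X Y \<Longrightarrow> h \<in> Mor T Y Z \<Longrightarrow>
      h \<cdot> (g \<cdot> f) = (h \<cdot> g) \<cdot> f"

locale linear_cat = cat +
  assumes Zero_Mor: "X \<in> Ob T \<Longrightarrow> Y \<in> Ob T \<Longrightarrow> Zero T X Y \<in> Mor T X Y"
    and Add_Mor: "f \<in> Mor T X Y \<Longrightarrow> g \<in> Mor T X Y \<Longrightarrow> f \<boxplus> g \<in> Mor T X Y"
    and Scale_Mor: "f \<in> Mor T X Y \<Longrightarrow> Scale T c f \<in> Mor T X Y"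
    and Add_assoc: "f \<in> Mor T X Y \<Longrightarrow> g \<in> Mor T X Y \<Longrightarrow> h \<in> Mor T X Y \<Longrightarrow>
      (f \<boxplus> g) \<boxplus> h = f \<boxplus> (g \<boxplus> h)"
    and Add_commute: "f \<in> Mor T X Y \<Longrightarrow> g \<in> Mor T X Y \<Longrightarrow> f \<boxplus> g = g \<boxplus> f"
    and Add_Zero: "f \<in> Mor T X Y \<Longrightarrow> f \<boxplus> Zero T X Y = f"
    and Add_inverse: "f \<in> Mor T X Y \<Longrightarrow> \<exists>g \<in> Mor T X Y. f \<boxplus> g = Zero T X Y"
    and Scale_Add: "f \<in> Mor T X Y \<Longrightarrow> g \<in> Mor T X Y \<Longrightarrow>
      Scale T c (f \<boxplus> g) = Scale T c f \<boxplus> Scale T c g"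
    and add_Scale: "f \<in> Mor T X Y \<Longrightarrow> Scale T (c + d) f = Scale T c f \<boxplus> Scale T d f"
    and mult_Scale: "f \<in> Mor T X Y \<Longrightarrow> Scale T (c * d) f = Scale T c (Scale T d f)"
    and one_Scale: "f \<in> Mor T X Y \<Longrightarrow> Scale T 1 f = f"
    and Comp_Add: "f \<in> Mor T X Y \<Longrightarrow> f' \<in> Mor T X Y \<Longrightarrow> g \<in> Mor T Y Z \<Longrightarrow>
      g \<cdot> (f \<boxplus> f') = (g \<cdot> f) \<boxplus> (g \<cdot> f')"
    and Add_Comp: "f \<in> Mor T X Y \<Longrightarrow> g \<in> Mor T Y Z \<Longrightarrow> g' \<in> Mor T Y Z \<Longrightarrow>
      (g \<boxplus> g') \<cdot> f = (g \<cdot> f) \<boxplus> (g' \<cdot> f)"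
    and Comp_Scale: "f \<in> Mor T X Y \<Longrightarrow> g \<in> Mor T Y Z \<Longrightarrow> g \<cdot> Scale T c f = Scale T c (g \<cdot> f)"
    and Scale_Comp: "f \<in> Mor T X Y \<Longrightarrow> g \<in> Mor T Y Z \<Longrightarrow> Scale T c g \<cdot> f = Scale T c (g \<cdot> f)"

definition zero_object :: "('o, 'a, 'k) tensor_cat \<Rightarrow> 'o \<Rightarrow> bool" where
  "zero_object T Z \<longleftrightarrow> Z \<in> Ob T \<and> (\<forall>X \<in> Ob T. (\<exists>!f. f \<in> Mor T X Z) \<and> (\<exists>!f. f \<in> Mor T Z X))"

definition is_kernel :: "('o, 'a, 'k) tensor_cat \<Rightarrow> 'a \<Rightarrow> 'a \<Rightarrow> bool" where
  "is_kernel T k f \<longleftrightarrow> k \<in> Arr T \<and> f \<in> Arr T \<and> Cod T k = Dom T f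
     \<and> f \<cdot>\<^bsub>T\<^esub> k = Zero T (Dom T k) (Cod T f)
     \<and> (\<forall>Z \<in> Ob T. \<forall>g \<in> Mor T Z (Dom T f). f \<cdot>\<^bsub>T\<^esub> g = Zero T Z (Cod T f) \<longrightarrow>
          (\<exists>!h. h \<in> Mor T Z (Dom T k) \<and> k \<cdot>\<^bsub>T\<^esub> h = g))"

definition is_cokernel :: "('o, 'a, 'k) tensor_cat \<Rightarrow> 'a \<Rightarrow> 'a \<Rightarrow> bool" where
  "is_cokernel T q f \<longleftrightarrow> q \<in> Arr T \<and> f \<in> Arr T \<and> Dom T q = Cod T f
     \<and> q \<cdot>\<^bsub>T\<^esub> f = Zero T (Dom T f) (Cod T q)
     \<and> (\<forall>Z \<in> Ob T. \<forall>g \<in> Mor T (Cod T f) Z. g \<cdot>\<^bsub>T\<^esub> f = Zero T (Dom T f) Z \<longrightarrow>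
          (\<exists>!h. h \<in> Mor T (Cod T q) Z \<and> h \<cdot>\<^bsub>T\<^esub> q = g))"

definition monic :: "('o, 'a, 'k) tensor_cat \<Rightarrow> 'a \<Rightarrow> bool" where
  "monic T f \<longleftrightarrow> f \<in> Arr T \<and> (\<forall>Z \<in> Ob T. \<forall>g \<in> Mor T Z (Dom T f). \<forall>h \<in> Mor T Z (Dom T f).
     f \<cdot>\<^bsub>T\<^esub> g = f \<cdot>\<^bsub>T\<^esub> h \<longrightarrow> g = h)"

definition epic :: "('o, 'a, 'k) tensor_cat \<Rightarrow> 'a \<Rightarrow> bool" where
  "epic T f \<longleftrightarrow> f \<in> Arr T \<and> (\<forall>Z \<in> Ob T. \<forall>g \<in> Mor T (Cod T f) Z. \<forall>h \<in> Mor T (Cod T f) Z.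
     g \<cdot>\<^bsub>T\<^esub> f = h \<cdot>\<^bsub>T\<^esub> f \<longrightarrow> g = h)"

definition inverse_arrows :: "('o, 'a, 'k) tensor_cat \<Rightarrow> 'a \<Rightarrow> 'a \<Rightarrow> bool" where
  "inverse_arrows T f g \<longleftrightarrow> f \<in> Arr T \<and> g \<in> Mor T (Cod T f) (Dom T f)
     \<and> g \<cdot>\<^bsub>T\<^esub> f = Id T (Dom T f) \<and> f \<cdot>\<^bsub>T\<^esub> g = Id T (Cod T f)"

definition is_iso :: "('o, 'a, 'k) tensor_cat \<Rightarrow> 'a \<Rightarrow> bool" where
  "is_iso T f \<longleftrightarrow> (\<exists>g. inverse_arrows T f g)"

text \<open>The sequence \<open>0 \<rightarrow> Dom i \<rightarrow> Cod i = Dom p \<rightarrow> Cod p \<rightarrow> 0\<close> with maps \<open>i\<close>, \<open>p\<close>.\<close>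

definition short_exact :: "('o, 'a, 'k) tensor_cat \<Rightarrow> 'a \<Rightarrow> 'a \<Rightarrow> bool" where
  "short_exact T i p \<longleftrightarrow> is_kernel T i p \<and> is_cokernel T p i"

locale abelian_cat = linear_cat +
  assumes ex_zero_object: "\<exists>Z. zero_object T Z"
    and ex_biproduct: "X \<in> Ob T \<Longrightarrow> Y \<in> Ob T \<Longrightarrow>
      \<exists>S \<in> Ob T. \<exists>i \<in> Mor T X S. \<exists>j \<in> Mor T Y S. \<exists>p \<in> Mor T S X. \<exists>q \<in> Mor T S Y.
        p \<cdot> i = Id T X \<and> q \<cdot> j = Id T Y \<and> p \<cdot> j = Zero T Y X \<and> q \<cdot> i = Zero T X Y
        \<and> (i \<cdot> p) \<boxplus> (j \<cdot> q) = Id T S"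
    and ex_kernel: "f \<in> Arr T \<Longrightarrow> \<exists>k. is_kernel T k f"
    and ex_cokernel: "f \<in> Arr T \<Longrightarrow> \<exists>q. is_cokernel T q f"
    and monic_is_kernel: "monic T f \<Longrightarrow> \<exists>g. is_kernel T f g"
    and epic_is_cokernel: "epic T f \<Longrightarrow> \<exists>g. is_cokernel T f g"

text \<open>A symmetric monoidal structure whose tensor product is \<open>K\<close>-bilinear on arrows.\<close>

locale abelian_tensor_cat = abelian_cat +
  assumes TensO_Ob: "X \<in> Ob T \<Longrightarrow> Y \<in> Ob T \<Longrightarrow> X \<odot> Y \<in> Ob T"
    and UnitO_Ob: "UnitO T \<in> Ob T"
    and TensA_Mor: "f \<in> Mor T X Y \<Longrightarrow> g \<in> Mor T X' Y' \<Longrightarrow> f \<star> g \<in> Mor T (X \<odot> X') (Y \<odot> Y')"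
    and TensA_Id: "X \<in> Ob T \<Longrightarrow> Y \<in> Ob T \<Longrightarrow> Id T X \<star> Id T Y = Id T (X \<odot> Y)"
    and TensA_Comp: "f \<in> Mor T X Y \<Longrightarrow> g \<in> Mor T Y Z \<Longrightarrow> f' \<in> Mor T X' Y' \<Longrightarrow> g' \<in> Mor T Y' Z' \<Longrightarrow>
      (g \<cdot> f) \<star> (g' \<cdot> f') = (g \<star> g') \<cdot> (f \<star> f')"
    and TensA_Add_left: "f \<in> Mor T X Y \<Longrightarrow> f' \<in> Mor T X Y \<Longrightarrow> g \<in> Mor T X' Y' \<Longrightarrow>
      (f \<boxplus> f') \<star> g = (f \<star> g) \<boxplus> (f' \<star> g)"
    and TensA_Add_right: "f \<in> Mor T X Y \<Longrightarrow> g \<in> Mor T X' Y' \<Longrightarrow> g' \<in> Mor T X' Y' \<Longrightarrow>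
      f \<star> (g \<boxplus> g') = (f \<star> g) \<boxplus> (f \<star> g')"
    and TensA_Scale_left: "f \<in> Mor T X Y \<Longrightarrow> g \<in> Mor T X' Y' \<Longrightarrow>
      Scale T c f \<star> g = Scale T c (f \<star> g)"
    and TensA_Scale_right: "f \<in> Mor T X Y \<Longrightarrow> g \<in> Mor T X' Y' \<Longrightarrow>
      f \<star> Scale T c g = Scale T c (f \<star> g)"
    and Assoc_Mor: "X \<in> Ob T \<Longrightarrow> Y \<in> Ob T \<Longrightarrow> Z \<in> Ob T \<Longrightarrow>
      Assoc T X Y Z \<in> Mor T ((X \<odot> Y) \<odot> Z) (X \<odot> (Y \<odot> Z))"
    and Assoc_iso: "X \<in> Ob T \<Longrightarrow> Y \<in> Ob T \<Longrightarrow> Z \<in> Ob T \<Longrightarrow> is_iso T (Assoc T X Y Z)"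
    and Assoc_natural: "f \<in> Mor T X X' \<Longrightarrow> g \<in> Mor T Y Y' \<Longrightarrow> h \<in> Mor T Z Z' \<Longrightarrow>
      Assoc T X' Y' Z' \<cdot> ((f \<star> g) \<star> h) = (f \<star> (g \<star> h)) \<cdot> Assoc T X Y Z"
    and LUnit_Mor: "X \<in> Ob T \<Longrightarrow> LUnit T X \<in> Mor T (UnitO T \<odot> X) X"
    and LUnit_iso: "X \<in> Ob T \<Longrightarrow> is_iso T (LUnit T X)"
    and LUnit_natural: "f \<in> Mor T X Y \<Longrightarrow> LUnit T Y \<cdot> (Id T (UnitO T) \<star> f) = f \<cdot> LUnit T X"
    and RUnit_Mor: "X \<in> Ob T \<Longrightarrow> RUnit T X \<in> Mor T (X \<odot> UnitO T) X"
    and RUnit_iso: "X \<in> Ob T \<Longrightarrow> is_iso T (RUnit T X)"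
    and RUnit_natural: "f \<in> Mor T X Y \<Longrightarrow> RUnit T Y \<cdot> (f \<star> Id T (UnitO T)) = f \<cdot> RUnit T X"
    and Braid_Mor: "X \<in> Ob T \<Longrightarrow> Y \<in> Ob T \<Longrightarrow> Braid T X Y \<in> Mor T (X \<odot> Y) (Y \<odot> X)"
    and Braid_natural: "f \<in> Mor T X X' \<Longrightarrow> g \<in> Mor T Y Y' \<Longrightarrow>
      Braid T X' Y' \<cdot> (f \<star> g) = (g \<star> f) \<cdot> Braid T X Y"
    and Braid_symmetric: "X \<in> Ob T \<Longrightarrow> Y \<in> Ob T \<Longrightarrow> Braid T Y X \<cdot> Braid T X Y = Id T (X \<odot> Y)"
    and pentagon: "W \<in> Ob T \<Longrightarrow> X \<in> Ob T \<Longrightarrow> Y \<in> Ob T \<Longrightarrow> Z \<in> Ob T \<Longrightarrow>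
      Assoc T W X (Y \<odot> Z) \<cdot> Assoc T (W \<odot> X) Y Z =
      (Id T W \<star> Assoc T X Y Z) \<cdot> Assoc T W (X \<odot> Y) Z \<cdot> (Assoc T W X Y \<star> Id T Z)"
    and triangle: "X \<in> Ob T \<Longrightarrow> Y \<in> Ob T \<Longrightarrow>
      (Id T X \<star> LUnit T Y) \<cdot> Assoc T X (UnitO T) Y = RUnit T X \<star> Id T Y"
    and hexagon: "X \<in> Ob T \<Longrightarrow> Y \<in> Ob T \<Longrightarrow> Z \<in> Ob T \<Longrightarrow>
      Assoc T Y Z X \<cdot> Braid T X (Y \<odot> Z) \<cdot> Assoc T X Y Z =
      (Id T Y \<star> Braid T X Z) \<cdot> Assoc T Y X Z \<cdot> (Braid T X Y \<star> Id T Z)"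

text \<open>
  Every object \<open>X\<close> has a dual \<open>X'\<close> with evaluation \<open>ev : X' \<otimes> X \<rightarrow> 1\<close> and coevaluation
  \<open>coev : 1 \<rightarrow> X \<otimes> X'\<close>. The two zigzag identities are written as equations between arrows
  \<open>1 \<otimes> X \<rightarrow> X\<close> and \<open>X' \<otimes> 1 \<rightarrow> X'\<close>, so that only the associator has to be inverted.
\<close>

locale rigid_abelian_tensor_cat = abelian_tensor_cat +
  assumes ex_dual: "X \<in> Ob T \<Longrightarrow>
      \<exists>X' \<in> Ob T. \<exists>ev \<in> Mor T (X' \<odot> X) (UnitO T). \<exists>coev \<in> Mor T (UnitO T) (X \<odot> X').
      \<exists>\<beta>. inverse_arrows T (Assoc T X' X X') \<beta>
        \<and> RUnit T X \<cdot> (Id T X \<star> ev) \<cdot> Assoc T X X' X \<cdot> (coev \<star> Id T X) = LUnit T X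
        \<and> LUnit T X' \<cdot> (ev \<star> Id T X') \<cdot> \<beta> \<cdot> (Id T X' \<star> coev) = RUnit T X'"
    and End_UnitO: "f \<in> Mor T (UnitO T) (UnitO T) \<Longrightarrow> \<exists>!c. f = Scale T c (Id T (UnitO T))"


section \<open>Fibre functors\<close>

text \<open>
  Finite dimensional vector spaces are taken in coordinates, as the category of the spaces \<open>K\<^sup>n\<close> and
  matrices. The tensor product \<open>K\<^sup>m \<otimes> K\<^sup>n = K\<^sup>m\<^sup>n\<close> uses the basis vectors
  \<open>e\<^sub>a \<otimes> e\<^sub>b = e\<^bsub>a n + b\<^esub>\<close>, for which it is strictly associative and unital.
\<close>

definition kron :: "'r::times mat \<Rightarrow> 'r mat \<Rightarrow> 'r mat" where
  "kron M N = mat (dim_row M * dim_row N) (dim_col M * dim_col N)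
     (\<lambda>(r, c). M $$ (r div dim_row N, c div dim_col N) * N $$ (r mod dim_row N, c mod dim_col N))"

text \<open>The exchange map \<open>K\<^sup>m \<otimes> K\<^sup>n \<rightarrow> K\<^sup>n \<otimes> K\<^sup>m\<close>, sending \<open>e\<^sub>a \<otimes> e\<^sub>b\<close> to \<open>e\<^sub>b \<otimes> e\<^sub>a\<close>.\<close>

definition swap_mat :: "nat \<Rightarrow> nat \<Rightarrow> 'r::zero_neq_one mat" where
  "swap_mat m n = mat (n * m) (m * n) (\<lambda>(r, c). if r = (c mod n) * m + c div n then 1 else 0)"

definition short_exact_mat :: "'k::field mat \<Rightarrow> 'k mat \<Rightarrow> bool" where
  "short_exact_mat M N \<longleftrightarrow> dim_row M = dim_col N
     \<and> {v \<in> carrier_vec (dim_col M). M *\<^sub>v v = 0\<^sub>v (dim_row M)} = {0\<^sub>v (dim_col M)}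
     \<and> {v \<in> carrier_vec (dim_col N). N *\<^sub>v v = 0\<^sub>v (dim_row N)} = (\<lambda>v. M *\<^sub>v v) ` carrier_vec (dim_col M)
     \<and> (\<lambda>v. N *\<^sub>v v) ` carrier_vec (dim_col N) = carrier_vec (dim_row N)"

text \<open>
  An object \<open>X\<close> is sent to \<open>K\<^bsup>fdim X\<^esup>\<close> and an arrow \<open>f\<close> to the matrix \<open>fmat f\<close>;
  \<open>ften X Y : \<omega> X \<otimes> \<omega> Y \<rightarrow> \<omega> (X \<otimes> Y)\<close> and \<open>funit : K \<rightarrow> \<omega> 1\<close> are the tensor structure.
\<close>

record ('o, 'a, 'k) fibre =
  fdim :: "'o \<Rightarrow> nat"
  fmat :: "'a \<Rightarrow> 'k mat"
  ften :: "'o \<Rightarrow> 'o \<Rightarrow> 'k mat"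
  funit :: "'k mat"

locale fibre_functor =
  fixes T :: "('o, 'a, 'k::field) tensor_cat" (structure)
    and \<omega> :: "('o, 'a, 'k) fibre"
  assumes fmat_carrier: "f \<in> Mor T X Y \<Longrightarrow> fmat \<omega> f \<in> carrier_mat (fdim \<omega> Y) (fdim \<omega> X)"
    and fmat_Id: "X \<in> Ob T \<Longrightarrow> fmat \<omega> (Id T X) = 1\<^sub>m (fdim \<omega> X)"
    and fmat_Comp: "f \<in> Mor T X Y \<Longrightarrow> g \<in> Mor T Y Z \<Longrightarrow> fmat \<omega> (g \<cdot> f) = fmat \<omega> g * fmat \<omega> f"
    and fmat_Add: "f \<in> Mor T X Y \<Longrightarrow> g \<in> Mor T X Y \<Longrightarrow> fmat \<omega> (f \<boxplus> g) = fmat \<omega> f + fmat \<omega> g"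
    and fmat_Scale: "f \<in> Mor T X Y \<Longrightarrow> fmat \<omega> (Scale T c f) = c \<cdot>\<^sub>m fmat \<omega> f"
    and faithful: "f \<in> Mor T X Y \<Longrightarrow> g \<in> Mor T X Y \<Longrightarrow> fmat \<omega> f = fmat \<omega> g \<Longrightarrow> f = g"
    and exact: "short_exact T i p \<Longrightarrow> short_exact_mat (fmat \<omega> i) (fmat \<omega> p)"
    and ften_carrier: "X \<in> Ob T \<Longrightarrow> Y \<in> Ob T \<Longrightarrow>
      ften \<omega> X Y \<in> carrier_mat (fdim \<omega> (X \<odot> Y)) (fdim \<omega> X * fdim \<omega> Y)"
    and ften_invertible: "X \<in> Ob T \<Longrightarrow> Y \<in> Ob T \<Longrightarrow> invertible_mat (ften \<omega> X Y)"
    and funit_carrier: "funit \<omega> \<in> carrier_mat (fdim \<omega> (UnitO T)) 1"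
    and funit_invertible: "invertible_mat (funit \<omega>)"
    and ften_natural: "f \<in> Mor T X Y \<Longrightarrow> g \<in> Mor T X' Y' \<Longrightarrow>
      fmat \<omega> (f \<star> g) * ften \<omega> X X' = ften \<omega> Y Y' * kron (fmat \<omega> f) (fmat \<omega> g)"
    and ften_Assoc: "X \<in> Ob T \<Longrightarrow> Y \<in> Ob T \<Longrightarrow> Z \<in> Ob T \<Longrightarrow>
      fmat \<omega> (Assoc T X Y Z) * ften \<omega> (X \<odot> Y) Z * kron (ften \<omega> X Y) (1\<^sub>m (fdim \<omega> Z)) =
      ften \<omega> X (Y \<odot> Z) * kron (1\<^sub>m (fdim \<omega> X)) (ften \<omega> Y Z)"
    and ften_LUnit: "X \<in> Ob T \<Longrightarrow>
      fmat \<omega> (LUnit T X) * ften \<omega> (UnitO T) X * kron (funit \<omega>) (1\<^sub>m (fdim \<omega> X)) = 1\<^sub>m (fdim \<omega> X)"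
    and ften_RUnit: "X \<in> Ob T \<Longrightarrow>
      fmat \<omega> (RUnit T X) * ften \<omega> X (UnitO T) * kron (1\<^sub>m (fdim \<omega> X)) (funit \<omega>) = 1\<^sub>m (fdim \<omega> X)"
    and ften_Braid: "X \<in> Ob T \<Longrightarrow> Y \<in> Ob T \<Longrightarrow>
      fmat \<omega> (Braid T X Y) * ften \<omega> X Y = ften \<omega> Y X * swap_mat (fdim \<omega> X) (fdim \<omega> Y)"

locale neutral_tannakian_cat = rigid_abelian_tensor_cat T
  for T :: "('o, 'a, 'k::field) tensor_cat" (structure) +
  assumes ex_fibre_functor: "\<exists>\<omega> :: ('o, 'a, 'k) fibre. fibre_functor T \<omega>"


section \<open>Affine group schemes and their representations\<close>

text \<open>
  An affine group scheme over \<open>K\<close> is given by its coordinate ring \<open>H\<close>, a commutative Hopf algebra,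
  with structure map \<open>eta : K \<rightarrow> H\<close>. The value of the comultiplication at \<open>h\<close> is given by a list
  of pairs \<open>(a\<^sub>i, b\<^sub>i)\<close> that represents \<open>\<Sum>\<^sub>i a\<^sub>i \<otimes> b\<^sub>i\<close>. As \<open>K\<close> is a field, two lists represent the
  same element of \<open>H \<otimes> H\<close> if and only if all pairs of \<open>K\<close>-linear functionals on \<open>H\<close> agree on
  them, and likewise for \<open>H \<otimes> H \<otimes> H\<close>.
\<close>

record ('k, 'h) hopf =
  eta :: "'k \<Rightarrow> 'h"
  comult :: "'h \<Rightarrow> ('h \<times> 'h) list"
  counit :: "'h \<Rightarrow> 'k"
  antipode :: "'h \<Rightarrow> 'h"

definition functionals :: "('k::field, 'h::comm_ring_1) hopf \<Rightarrow> ('h \<Rightarrow> 'k) set" where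
  "functionals G = {\<phi>. (\<forall>x y. \<phi> (x + y) = \<phi> x + \<phi> y) \<and> (\<forall>c x. \<phi> (eta G c * x) = c * \<phi> x)}"

definition tensor_eq :: "('k::field, 'h::comm_ring_1) hopf \<Rightarrow> ('h \<times> 'h) list \<Rightarrow> ('h \<times> 'h) list \<Rightarrow> bool"
  where
  "tensor_eq G s t \<longleftrightarrow> (\<forall>\<phi> \<in> functionals G. \<forall>\<psi> \<in> functionals G.
     (\<Sum>(a, b)\<leftarrow>s. \<phi> a * \<psi> b) = (\<Sum>(a, b)\<leftarrow>t. \<phi> a * \<psi> b))"

definition tensor_eq3 ::
  "('k::field, 'h::comm_ring_1) hopf \<Rightarrow> ('h \<times> 'h \<times> 'h) list \<Rightarrow> ('h \<times> 'h \<times> 'h) list \<Rightarrow> bool" where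
  "tensor_eq3 G s t \<longleftrightarrow> (\<forall>\<phi> \<in> functionals G. \<forall>\<psi> \<in> functionals G. \<forall>\<chi> \<in> functionals G.
     (\<Sum>(a, b, c)\<leftarrow>s. \<phi> a * \<psi> b * \<chi> c) = (\<Sum>(a, b, c)\<leftarrow>t. \<phi> a * \<psi> b * \<chi> c))"

locale affine_group_scheme =
  fixes G :: "('k::field, 'h::comm_ring_1) hopf"
  assumes eta_add: "eta G (c + d) = eta G c + eta G d"
    and eta_mult: "eta G (c * d) = eta G c * eta G d"
    and eta_one: "eta G 1 = 1"
    and counit_add: "counit G (x + y) = counit G x + counit G y"
    and counit_mult: "counit G (x * y) = counit G x * counit G y"
    and counit_eta: "counit G (eta G c) = c"
    and comult_add: "tensor_eq G (comult G (x + y)) (comult G x @ comult G y)"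
    and comult_mult: "tensor_eq G (comult G (x * y))
      [(a * c, b * d). (a, b) \<leftarrow> comult G x, (c, d) \<leftarrow> comult G y]"
    and comult_eta: "tensor_eq G (comult G (eta G c)) [(eta G c, 1)]"
    and antipode_add: "antipode G (x + y) = antipode G x + antipode G y"
    and antipode_linear: "antipode G (eta G c * x) = eta G c * antipode G x"
    and coassociative: "tensor_eq3 G
      [(a', a'', b). (a, b) \<leftarrow> comult G x, (a', a'') \<leftarrow> comult G a]
      [(a, b', b''). (a, b) \<leftarrow> comult G x, (b', b'') \<leftarrow> comult G b]"
    and counit_left: "(\<Sum>(a, b)\<leftarrow>comult G x. eta G (counit G a) * b) = x"
    and counit_right: "(\<Sum>(a, b)\<leftarrow>comult G x. a * eta G (counit G b)) = x"
    and antipode_left: "(\<Sum>(a, b)\<leftarrow>comult G x. antipode G a * b) = eta G (counit G x)"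
    and antipode_right: "(\<Sum>(a, b)\<leftarrow>comult G x. a * antipode G b) = eta G (counit G x)"

text \<open>
  A representation of \<open>G\<close> on \<open>K\<^sup>n\<close> is the matrix \<open>r\<close> over the coordinate ring through which the
  universal point of \<open>G\<close> acts: a point \<open>\<chi> : H \<rightarrow> R\<close> acts on \<open>R\<^sup>n\<close> by \<open>map_mat \<chi> r\<close>. Equivalently
  \<open>e\<^sub>j \<mapsto> \<Sum>\<^sub>i e\<^sub>i \<otimes> r\<^sub>i\<^sub>j\<close> is a comodule structure on \<open>K\<^sup>n\<close>.
\<close>

definition representation :: "('k::field, 'h::comm_ring_1) hopf \<Rightarrow> nat \<Rightarrow> 'h mat \<Rightarrow> bool" where
  "representation G n r \<longleftrightarrow> r \<in> carrier_mat n n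
     \<and> map_mat (counit G) r = 1\<^sub>m n
     \<and> (\<forall>i < n. \<forall>j < n.
          tensor_eq G (comult G (r $$ (i, j))) [(r $$ (i, k), r $$ (k, j)). k \<leftarrow> [0..<n]])"

definition intertwines ::
  "('k::field, 'h::comm_ring_1) hopf \<Rightarrow> 'k mat \<Rightarrow> 'h mat \<Rightarrow> 'h mat \<Rightarrow> bool" where
  "intertwines G M r s \<longleftrightarrow> map_mat (eta G) M * r = s * map_mat (eta G) M"

text \<open>
  The identification of \<open>T\<close> with the category of finite dimensional representations of \<open>G\<close> given by
  the fibre functor \<open>\<omega>\<close>: \<open>G\<close> acts on every \<open>\<omega> X\<close> through \<open>\<rho> X\<close>, compatibly with tensor products, and
  \<open>X \<mapsto> (\<omega> X, \<rho> X)\<close> is full and essentially surjective (it is faithful because \<open>\<omega>\<close> is).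
\<close>

locale tannakian_identification = fibre_functor T \<omega> + affine_group_scheme G
  for T :: "('o, 'a, 'k::field) tensor_cat" (structure)
    and \<omega> :: "('o, 'a, 'k) fibre"
    and G :: "('k, 'h::comm_ring_1) hopf" +
  fixes \<rho> :: "'o \<Rightarrow> 'h mat"
  assumes rho_representation: "X \<in> Ob T \<Longrightarrow> representation G (fdim \<omega> X) (\<rho> X)"
    and rho_natural: "f \<in> Mor T X Y \<Longrightarrow> intertwines G (fmat \<omega> f) (\<rho> X) (\<rho> Y)"
    and rho_tensor: "X \<in> Ob T \<Longrightarrow> Y \<in> Ob T \<Longrightarrow>
      intertwines G (ften \<omega> X Y) (kron (\<rho> X) (\<rho> Y)) (\<rho> (X \<odot> Y))"
    and rho_unit: "intertwines G (funit \<omega>) (1\<^sub>m 1) (\<rho> (UnitO T))"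
    and full: "X \<in> Ob T \<Longrightarrow> Y \<in> Ob T \<Longrightarrow> M \<in> carrier_mat (fdim \<omega> Y) (fdim \<omega> X) \<Longrightarrow>
      intertwines G M (\<rho> X) (\<rho> Y) \<Longrightarrow> \<exists>f \<in> Mor T X Y. fmat \<omega> f = M"
    and essentially_surjective: "representation G n r \<Longrightarrow>
      \<exists>X \<in> Ob T. \<exists>M \<in> carrier_mat (fdim \<omega> X) n. invertible_mat M \<and> intertwines G M r (\<rho> X)"


section \<open>Tannakian groups and the Lie algebra of an extension\<close>

inductive_set subalgebra_gen :: "('k::field, 'h::comm_ring_1) hopf \<Rightarrow> 'h set \<Rightarrow> 'h set"
  for G :: "('k, 'h) hopf" and S :: "'h set" where
  scalar: "eta G c \<in> subalgebra_gen G S"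
| gen: "x \<in> S \<Longrightarrow> x \<in> subalgebra_gen G S"
| add: "x \<in> subalgebra_gen G S \<Longrightarrow> y \<in> subalgebra_gen G S \<Longrightarrow> x + y \<in> subalgebra_gen G S"
| mult: "x \<in> subalgebra_gen G S \<Longrightarrow> y \<in> subalgebra_gen G S \<Longrightarrow> x * y \<in> subalgebra_gen G S"

inductive_set ideal_gen :: "'h::comm_ring_1 set \<Rightarrow> 'h set \<Rightarrow> 'h set"
  for R :: "'h set" and S :: "'h set" where
  zero: "0 \<in> ideal_gen R S"
| add: "x \<in> ideal_gen R S \<Longrightarrow> a \<in> R \<Longrightarrow> s \<in> S \<Longrightarrow> x + a * s \<in> ideal_gen R S"

text \<open>
  The coordinate ring of the image of \<open>G\<close> in \<open>GL\<^sub>n\<close> under the representation \<open>r\<close>. It is the image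
  of \<open>K[x\<^sub>i\<^sub>j, det\<^sup>-\<^sup>1] \<rightarrow> H\<close>, \<open>x\<^sub>i\<^sub>j \<mapsto> r\<^sub>i\<^sub>j\<close>.
\<close>

definition image_ring :: "('k::field, 'h::comm_ring_1) hopf \<Rightarrow> 'h mat \<Rightarrow> 'h set" where
  "image_ring G r = subalgebra_gen G (elements_mat r \<union> {d. d * det r = 1})"

definition dsum_rep :: "'h::comm_ring_1 mat \<Rightarrow> 'h mat \<Rightarrow> 'h mat" where
  "dsum_rep r s = four_block_mat r (0\<^sub>m (dim_row r) (dim_col s)) (0\<^sub>m (dim_row s) (dim_col r)) s"

text \<open>
  The ideal of \<open>\<U>(E)\<close> in the coordinate ring of \<open>\<G>(E)\<close>. The surjection \<open>\<G>(E) \<rightarrow> \<G>(A \<oplus> B)\<close>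
  corresponds to the inclusion of coordinate rings in \<open>H\<close>, so that its kernel is cut out by the
  augmentation ideal of the coordinate ring of \<open>\<G>(A \<oplus> B)\<close>.
\<close>

definition kernel_ideal ::
  "('k::field, 'h::comm_ring_1) hopf \<Rightarrow> ('o \<Rightarrow> 'h mat) \<Rightarrow> 'o \<Rightarrow> 'o \<Rightarrow> 'o \<Rightarrow> 'h set" where
  "kernel_ideal G \<rho> A B E =
     ideal_gen (image_ring G (\<rho> E)) {h \<in> image_ring G (dsum_rep (\<rho> A) (\<rho> B)). counit G h = 0}"

text \<open>
  The tangent space at the identity of the closed subgroup scheme with ideal \<open>I\<close> of the group scheme
  with coordinate ring \<open>R\<close>: the derivations \<open>R/I \<rightarrow> K\<close>, where \<open>K\<close> is a module through the counit.
  Such a \<open>D\<close> is the tangent vector \<open>counit + \<epsilon> D : R/I \<rightarrow> K[\<epsilon>]\<close>. Only the values on \<open>R\<close> matter.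
\<close>

definition point_derivations ::
  "('k::field, 'h::comm_ring_1) hopf \<Rightarrow> 'h set \<Rightarrow> 'h set \<Rightarrow> ('h \<Rightarrow> 'k) set" where
  "point_derivations G R I = {D.
     (\<forall>x \<in> R. \<forall>y \<in> R. D (x + y) = D x + D y) \<and>
     (\<forall>c. \<forall>x \<in> R. D (eta G c * x) = c * D x) \<and>
     (\<forall>x \<in> R. \<forall>y \<in> R. D (x * y) = counit G x * D y + D x * counit G y) \<and>
     (\<forall>x \<in> I. D x = 0)}"

text \<open>
  \<open>\<uu>(E)\<close> as a space of matrices \<open>f : \<omega> A \<rightarrow> \<omega> B\<close>. The tangent vector \<open>D\<close> acts on \<open>\<omega> E\<close> through
  the matrix \<open>map_mat D (\<rho> E)\<close>, and \<open>f\<close> acts as \<open>i f p\<close>, which is the block matrix with upper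
  right entry \<open>f\<close> and zeros elsewhere for every section of \<open>p\<close>; its exponential is \<open>1 + i f p\<close>.
\<close>

definition lie_u ::
  "('o, 'a, 'k::field) tensor_cat \<Rightarrow> ('o, 'a, 'k) fibre \<Rightarrow> ('k, 'h::comm_ring_1) hopf \<Rightarrow> ('o \<Rightarrow> 'h mat)
   \<Rightarrow> 'a \<Rightarrow> 'a \<Rightarrow> 'k mat set" where
  "lie_u T \<omega> G \<rho> i p = (let B = Dom T i; E = Cod T i; A = Cod T p in
     {f \<in> carrier_mat (fdim \<omega> B) (fdim \<omega> A).
        \<exists>D \<in> point_derivations G (image_ring G (\<rho> E)) (kernel_ideal G \<rho> A B E).
          map_mat D (\<rho> E) = fmat \<omega> i * f * fmat \<omega> p})"


section \<open>Endomorphisms preserving a subobject\<close>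

text \<open>The endomorphisms of \<open>E = Cod i\<close> that map the subobject \<open>i : B \<rightarrow> E\<close> to itself.\<close>

definition End_sub :: "('o, 'a, 'k) tensor_cat \<Rightarrow> 'a \<Rightarrow> 'a set" where
  "End_sub T i = {\<phi> \<in> Mor T (Cod T i) (Cod T i).
     \<exists>\<psi> \<in> Mor T (Dom T i) (Dom T i). \<phi> \<cdot>\<^bsub>T\<^esub> i = i \<cdot>\<^bsub>T\<^esub> \<psi>}"

definition restrict_sub :: "('o, 'a, 'k) tensor_cat \<Rightarrow> 'a \<Rightarrow> 'a \<Rightarrow> 'a" where
  "restrict_sub T i \<phi> = (THE \<psi>. \<psi> \<in> Mor T (Dom T i) (Dom T i) \<and> i \<cdot>\<^bsub>T\<^esub> \<psi> = \<phi> \<cdot>\<^bsub>T\<^esub> i)"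

definition induced_quot :: "('o, 'a, 'k) tensor_cat \<Rightarrow> 'a \<Rightarrow> 'a \<Rightarrow> 'a" where
  "induced_quot T p \<phi> = (THE \<psi>. \<psi> \<in> Mor T (Cod T p) (Cod T p) \<and> \<psi> \<cdot>\<^bsub>T\<^esub> p = p \<cdot>\<^bsub>T\<^esub> \<phi>)"

definition Omega :: "('o, 'a, 'k) tensor_cat \<Rightarrow> 'a \<Rightarrow> 'a \<Rightarrow> 'a \<Rightarrow> 'a \<times> 'a" where
  "Omega T i p \<phi> = (restrict_sub T i \<phi>, induced_quot T p \<phi>)"

end

theory Submission
  imports Defs
begin

text \<open>
  Apply the fibre functor. An endomorphism \<open>\<phi>\<close> of \<open>E\<close> that preserves \<open>B\<close> becomes a matrix commuting
  with \<open>\<G>\<close>, and differentiating this relation at the identity shows that it commutes with the Lie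
  algebra of \<open>\<G>(E)\<close>, in particular with \<open>i f p\<close> for every \<open>f \<in> \<uu>(E)\<close> (\<open>intertwiner_commutes_tangent\<close>).
  Since \<open>\<phi> i = i \<phi>\<^sub>B\<close> and \<open>p \<phi> = \<phi>\<^sub>A p\<close>, this reads \<open>i (\<phi>\<^sub>B f) p = i (f \<phi>\<^sub>A) p\<close>, and as \<open>i\<close> is injective
  and \<open>p\<close> surjective, \<open>\<phi>\<^sub>B f = f \<phi>\<^sub>A\<close>. When \<open>\<uu>(E)\<close> is all of \<open>Hom(A, B)\<close> this holds for every linear
  map \<open>f : A \<rightarrow> B\<close>; testing it on the elementary matrices, which exist because \<open>A\<close> and \<open>B\<close> are nonzero,
  forces \<open>\<phi>\<^sub>A\<close> and \<open>\<phi>\<^sub>B\<close> to be multiplication by one common scalar (\<open>universal_intertwiners_scalar\<close>).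
  Faithfulness of the fibre functor carries this back to \<open>T\<close>. Conversely \<open>a \<cdot> Id\<^sub>E\<close> has image
  \<open>(a \<cdot> Id\<^sub>B, a \<cdot> Id\<^sub>A)\<close>.
\<close>

section \<open>Matrices\<close>

lemma mat_eq_if_mult_vec_eq:
  fixes X Y :: "'r::comm_ring_1 mat"
  assumes X: "X \<in> carrier_mat m n" and Y: "Y \<in> carrier_mat m n"
    and eq: "\<And>v. v \<in> carrier_vec n \<Longrightarrow> X *\<^sub>v v = Y *\<^sub>v v"
  shows "X = Y"
proof (rule mat_col_eqI)
  fix j assume "j < dim_col Y"
  with Y have j: "j < n" by simp
  show "col X j = col Y j"
    using eq[of "unit_vec n j"] col_mult2[OF X one_carrier_mat j] col_mult2[OF Y one_carrier_mat j]
      X Y j by simp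
qed (use X Y in auto)

lemma short_exact_mat_cancel_left:
  fixes M N X Y :: "'k::field mat"
  assumes se: "short_exact_mat M N"
    and X: "X \<in> carrier_mat (dim_col M) n" and Y: "Y \<in> carrier_mat (dim_col M) n"
    and eq: "M * X = M * Y"
  shows "X = Y"
proof (rule mat_eq_if_mult_vec_eq[OF X Y])
  fix v :: "'k vec" assume v: "v \<in> carrier_vec n"
  have M: "M \<in> carrier_mat (dim_row M) (dim_col M)" by simp
  have Xv: "X *\<^sub>v v \<in> carrier_vec (dim_col M)" and Yv: "Y *\<^sub>v v \<in> carrier_vec (dim_col M)"
    using X Y v by auto
  have "M *\<^sub>v (X *\<^sub>v v) = M *\<^sub>v (Y *\<^sub>v v)"
    using assoc_mult_mat_vec[OF M X v] assoc_mult_mat_vec[OF M Y v] eq by simp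
  then have "M *\<^sub>v (X *\<^sub>v v - Y *\<^sub>v v) = 0\<^sub>v (dim_row M)"
    using mult_minus_distrib_mat_vec[OF M Xv Yv] mult_mat_vec_carrier[OF M Yv] by simp
  then have "X *\<^sub>v v - Y *\<^sub>v v \<in> {v \<in> carrier_vec (dim_col M). M *\<^sub>v v = 0\<^sub>v (dim_row M)}"
    using Xv Yv by simp
  then have diff: "X *\<^sub>v v - Y *\<^sub>v v = 0\<^sub>v (dim_col M)"
    using se unfolding short_exact_mat_def by blast
  show "X *\<^sub>v v = Y *\<^sub>v v"
  proof (rule eq_vecI)
    fix k assume "k < dim_vec (Y *\<^sub>v v)"
    then have "k < dim_col M" using Yv by (metis carrier_vecD)
    then have "(X *\<^sub>v v - Y *\<^sub>v v) $ k = 0" using diff by simp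
    with \<open>k < dim_vec (Y *\<^sub>v v)\<close> show "(X *\<^sub>v v) $ k = (Y *\<^sub>v v) $ k" by simp
  qed (use X Y in auto)
qed

lemma short_exact_mat_cancel_right:
  fixes M N X Y :: "'k::field mat"
  assumes se: "short_exact_mat M N"
    and X: "X \<in> carrier_mat m (dim_row N)" and Y: "Y \<in> carrier_mat m (dim_row N)"
    and eq: "X * N = Y * N"
  shows "X = Y"
proof (rule mat_eq_if_mult_vec_eq[OF X Y])
  fix v :: "'k vec" assume "v \<in> carrier_vec (dim_row N)"
  then have "v \<in> (\<lambda>v. N *\<^sub>v v) ` carrier_vec (dim_col N)"
    using se unfolding short_exact_mat_def by blast
  then obtain w where w: "w \<in> carrier_vec (dim_col N)" and v: "v = N *\<^sub>v w" by blast
  have N: "N \<in> carrier_mat (dim_row N) (dim_col N)" by simp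
  show "X *\<^sub>v v = Y *\<^sub>v v"
    using assoc_mult_mat_vec[OF X N w] assoc_mult_mat_vec[OF Y N w] eq v by simp
qed

text \<open>
  For the elementary matrix \<open>f = e\<^sub>k\<^sub>l\<close> the product \<open>P f\<close> is column \<open>k\<close> of \<open>P\<close> put into column \<open>l\<close>, and
  \<open>f Q\<close> is row \<open>l\<close> of \<open>Q\<close> put into row \<open>k\<close>. These overlap only in the entry \<open>(k, l)\<close>, where they give
  \<open>P\<^sub>k\<^sub>k = Q\<^sub>l\<^sub>l\<close>; the others give the vanishing of the off-diagonal entries of \<open>P\<close> and \<open>Q\<close>.
\<close>

lemma universal_intertwiners_scalar:
  fixes P Q :: "'r::comm_ring_1 mat"
  assumes P: "P \<in> carrier_mat m m" and Q: "Q \<in> carrier_mat n n"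
    and pos: "0 < m" "0 < n"
    and comm: "\<And>f. f \<in> carrier_mat m n \<Longrightarrow> P * f = f * Q"
  obtains a where "P = a \<cdot>\<^sub>m 1\<^sub>m m" "Q = a \<cdot>\<^sub>m 1\<^sub>m n"
proof -
  have entry: "(if s = l then P $$ (r, k) else 0) = (if r = k then Q $$ (l, s) else 0)"
    if "r < m" "k < m" "l < n" "s < n" for r k l s
  proof -
    define f :: "'r mat" where "f = mat m n (\<lambda>(x, y). if x = k \<and> y = l then 1 else 0)"
    have f: "f \<in> carrier_mat m n" by (simp add: f_def)
    have "(P * f) $$ (r, s) = (\<Sum>x = 0..<m. P $$ (r, x) * f $$ (x, s))"
      using that P f by (simp add: scalar_prod_def)
    also have "\<dots> = (\<Sum>x = 0..<m. if x = k then (if s = l then P $$ (r, k) else 0) else 0)"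
      by (rule sum.cong) (use that in \<open>auto simp: f_def\<close>)
    finally have Pf: "(P * f) $$ (r, s) = (if s = l then P $$ (r, k) else 0)"
      using that by simp
    have "(f * Q) $$ (r, s) = (\<Sum>y = 0..<n. f $$ (r, y) * Q $$ (y, s))"
      using that Q f by (simp add: scalar_prod_def)
    also have "\<dots> = (\<Sum>y = 0..<n. if y = l then (if r = k then Q $$ (l, s) else 0) else 0)"
      by (rule sum.cong) (use that in \<open>auto simp: f_def\<close>)
    finally have "(f * Q) $$ (r, s) = (if r = k then Q $$ (l, s) else 0)"
      using that by simp
    with Pf comm[OF f] show ?thesis by simp
  qed
  define a where "a = P $$ (0, 0)"
  have Q0: "Q $$ (0, 0) = a" using entry[of 0 0 0 0] pos by (simp add: a_def)
  have Pe: "P $$ (r, k) = (if r = k then a else 0)" if "r < m" "k < m" for r k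
    using entry[OF that pos(2) pos(2)] Q0 by simp
  have Qe: "Q $$ (l, s) = (if l = s then a else 0)" if "l < n" "s < n" for l s
    using entry[OF pos(1) pos(1) that] by (auto simp: a_def)
  have "P = a \<cdot>\<^sub>m 1\<^sub>m m"
    by (rule eq_matI) (use P Pe in auto)
  moreover have "Q = a \<cdot>\<^sub>m 1\<^sub>m n"
    by (rule eq_matI) (use Q Qe in auto)
  ultimately show thesis by (rule that)
qed

section \<open>Intertwiners and tangent vectors\<close>

text \<open>
  The entries of \<open>M r = r M\<close> are \<open>K\<close>-linear relations between the entries of \<open>r\<close>, all inside the
  coordinate ring of the image group, so the linear map \<open>D\<close> can be applied to them.
\<close>

lemma intertwiner_commutes_tangent:
  fixes G :: "('k::field, 'h::comm_ring_1) hopf"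
  assumes "affine_group_scheme G"
    and M: "M \<in> carrier_mat n n" and r: "r \<in> carrier_mat n n"
    and inter: "intertwines G M r r"
    and D: "D \<in> point_derivations G (image_ring G r) I"
  shows "M * map_mat D r = map_mat D r * M"
proof -
  interpret affine_group_scheme G by fact
  let ?R = "image_ring G r"
  have eta_zero: "eta G 0 = 0" using eta_add[of 0 0] by simp
  have entry: "r $$ (k, l) \<in> ?R" if "k < n" "l < n" for k l
    unfolding image_ring_def by (rule subalgebra_gen.gen) (use r that in auto)
  have R_zero: "0 \<in> ?R"
    unfolding image_ring_def using subalgebra_gen.scalar[of G 0] eta_zero by simp
  have R_add: "x + y \<in> ?R" if "x \<in> ?R" "y \<in> ?R" for x y
    using that unfolding image_ring_def by (rule subalgebra_gen.add)
  have R_scale: "eta G c * x \<in> ?R" if "x \<in> ?R" for c x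
    using that unfolding image_ring_def by (blast intro: subalgebra_gen.mult subalgebra_gen.scalar)
  have D_add: "D (x + y) = D x + D y" if "x \<in> ?R" "y \<in> ?R" for x y
    using D that by (simp add: point_derivations_def)
  have D_scale: "D (eta G c * x) = c * D x" if "x \<in> ?R" for c x
    using D that by (simp add: point_derivations_def)
  have "D 0 = D 0 + D 0" using D_add[OF R_zero R_zero] by simp
  then have D_zero: "D 0 = 0" by (metis add_cancel_right_right)
  have D_sum: "D (\<Sum>k\<in>S. eta G (c k) * g k) = (\<Sum>k\<in>S. c k * D (g k))"
    if "finite S" "\<forall>k\<in>S. g k \<in> ?R" for S :: "nat set" and c g
  proof -
    have "(\<Sum>k\<in>S. eta G (c k) * g k) \<in> ?R \<and> D (\<Sum>k\<in>S. eta G (c k) * g k) = (\<Sum>k\<in>S. c k * D (g k))"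
      using that by (induction S) (auto simp: R_zero D_zero R_add R_scale D_add D_scale)
    then show ?thesis ..
  qed
  show ?thesis
  proof (rule eq_matI)
    fix a b assume "a < dim_row (map_mat D r * M)" "b < dim_col (map_mat D r * M)"
    then have a: "a < n" and b: "b < n" using M r by auto
    have "(map_mat (eta G) M * r) $$ (a, b) = (r * map_mat (eta G) M) $$ (a, b)"
      using inter by (simp add: intertwines_def)
    then have "(\<Sum>k = 0..<n. eta G (M $$ (a, k)) * r $$ (k, b)) =
        (\<Sum>k = 0..<n. eta G (M $$ (k, b)) * r $$ (a, k))"
      using M r a b by (simp add: scalar_prod_def mult.commute)
    then have "D (\<Sum>k = 0..<n. eta G (M $$ (a, k)) * r $$ (k, b)) =
        D (\<Sum>k = 0..<n. eta G (M $$ (k, b)) * r $$ (a, k))" by simp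
    then have "(\<Sum>k = 0..<n. M $$ (a, k) * D (r $$ (k, b))) =
        (\<Sum>k = 0..<n. M $$ (k, b) * D (r $$ (a, k)))"
      using a b entry by (simp add: D_sum)
    then show "(M * map_mat D r) $$ (a, b) = (map_mat D r * M) $$ (a, b)"
      using M r a b by (simp add: scalar_prod_def mult.commute)
  qed (use M r in auto)
qed

section \<open>Reading arrows off their matrices\<close>

locale fibred_linear_cat = linear_cat T + fibre_functor T \<omega>
  for T :: "('o, 'a, 'k::field) tensor_cat" (structure) and \<omega> :: "('o, 'a, 'k) fibre"
begin

lemma Mor_Ob: "f \<in> Mor T X Y \<Longrightarrow> X \<in> Ob T \<and> Y \<in> Ob T"
  using Dom_Ob Cod_Ob by (auto simp: Mor_def)

lemma Scale_Id_Mor: "X \<in> Ob T \<Longrightarrow> Scale T a (Id T X) \<in> Mor T X X"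
  by (simp add: Scale_Mor Id_Mor)

lemma fmat_Zero:
  assumes "X \<in> Ob T" "Y \<in> Ob T"
  shows "fmat \<omega> (Zero T X Y) = 0\<^sub>m (fdim \<omega> Y) (fdim \<omega> X)"
proof -
  let ?Z = "fmat \<omega> (Zero T X Y)"
  have mor: "Zero T X Y \<in> Mor T X Y" using assms by (rule Zero_Mor)
  then have Z: "?Z \<in> carrier_mat (fdim \<omega> Y) (fdim \<omega> X)" by (rule fmat_carrier)
  have sum: "?Z + ?Z = ?Z" using fmat_Add[OF mor mor] Add_Zero[OF mor] by simp
  show ?thesis
  proof (rule eq_matI)
    fix a b assume "a < dim_row (0\<^sub>m (fdim \<omega> Y) (fdim \<omega> X) :: 'k mat)"
      "b < dim_col (0\<^sub>m (fdim \<omega> Y) (fdim \<omega> X) :: 'k mat)"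
    then have ab: "a < fdim \<omega> Y" "b < fdim \<omega> X" by auto
    have "?Z $$ (a, b) = (?Z + ?Z) $$ (a, b)" using sum by simp
    also have "\<dots> = ?Z $$ (a, b) + ?Z $$ (a, b)" using Z ab by simp
    finally have "?Z $$ (a, b) = 0" by (metis add_cancel_right_right)
    with ab show "?Z $$ (a, b) = 0\<^sub>m (fdim \<omega> Y) (fdim \<omega> X) $$ (a, b)" by simp
  qed (use Z in auto)
qed

text \<open>
  A faithful functor reflects zero objects: between objects one of which has fibre zero there is
  only the empty matrix, so there is only the zero arrow.
\<close>

lemma fdim_pos_if_nonzero:
  assumes X: "X \<in> Ob T" and nz: "\<not> zero_object T X"
  shows "0 < fdim \<omega> X"
proof (rule ccontr)
  assume "\<not> 0 < fdim \<omega> X"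
  then have dim: "fdim \<omega> X = 0" by simp
  have unique: "\<exists>!f. f \<in> Mor T Y Z"
    if YZ: "Y \<in> Ob T" "Z \<in> Ob T" and "fdim \<omega> Y = 0 \<or> fdim \<omega> Z = 0" for Y Z
  proof (rule ex1I)
    show "Zero T Y Z \<in> Mor T Y Z" using YZ by (rule Zero_Mor)
    fix f assume f: "f \<in> Mor T Y Z"
    have "fmat \<omega> f = 0\<^sub>m (fdim \<omega> Z) (fdim \<omega> Y)"
      by (rule eq_matI) (use fmat_carrier[OF f] that(3) in auto)
    then show "f = Zero T Y Z"
      using faithful[OF f Zero_Mor[OF YZ]] fmat_Zero[OF YZ] by simp
  qed
  have "zero_object T X" unfolding zero_object_def using X dim unique by blast
  with nz show False ..
qed

lemma restrict_sub_eq: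
  assumes i: "i \<in> Mor T B E" and se: "short_exact T i p"
    and \<psi>: "\<psi> \<in> Mor T B B" and eq: "i \<cdot> \<psi> = \<phi> \<cdot> i"
  shows "restrict_sub T i \<phi> = \<psi>"
proof -
  have Dom: "Dom T i = B" using i by (simp add: Mor_def)
  show ?thesis unfolding restrict_sub_def Dom
  proof (rule the_equality)
    show "\<psi> \<in> Mor T B B \<and> i \<cdot> \<psi> = \<phi> \<cdot> i" using \<psi> eq by simp
    fix \<psi>' assume "\<psi>' \<in> Mor T B B \<and> i \<cdot> \<psi>' = \<phi> \<cdot> i"
    then have \<psi>': "\<psi>' \<in> Mor T B B" and "i \<cdot> \<psi>' = i \<cdot> \<psi>" using eq by auto
    then have "fmat \<omega> i * fmat \<omega> \<psi>' = fmat \<omega> i * fmat \<omega> \<psi>"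
      using fmat_Comp[OF \<psi> i] fmat_Comp[OF \<psi>' i] by simp
    then have "fmat \<omega> \<psi>' = fmat \<omega> \<psi>"
      using short_exact_mat_cancel_left[OF exact[OF se]] fmat_carrier[OF i]
        fmat_carrier[OF \<psi>] fmat_carrier[OF \<psi>'] by auto
    then show "\<psi>' = \<psi>" by (rule faithful[OF \<psi>' \<psi>])
  qed
qed

lemma induced_quot_eq:
  assumes p: "p \<in> Mor T E A" and se: "short_exact T i p"
    and \<psi>: "\<psi> \<in> Mor T A A" and eq: "\<psi> \<cdot> p = p \<cdot> \<phi>"
  shows "induced_quot T p \<phi> = \<psi>"
proof -
  have Cod: "Cod T p = A" using p by (simp add: Mor_def)
  show ?thesis unfolding induced_quot_def Cod
  proof (rule the_equality)
    show "\<psi> \<in> Mor T A A \<and> \<psi> \<cdot> p = p \<cdot> \<phi>" using \<psi> eq by simp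
    fix \<psi>' assume "\<psi>' \<in> Mor T A A \<and> \<psi>' \<cdot> p = p \<cdot> \<phi>"
    then have \<psi>': "\<psi>' \<in> Mor T A A" and "\<psi>' \<cdot> p = \<psi> \<cdot> p" using eq by auto
    then have "fmat \<omega> \<psi>' * fmat \<omega> p = fmat \<omega> \<psi> * fmat \<omega> p"
      using fmat_Comp[OF p \<psi>] fmat_Comp[OF p \<psi>'] by simp
    then have "fmat \<omega> \<psi>' = fmat \<omega> \<psi>"
      using short_exact_mat_cancel_right[OF exact[OF se]] fmat_carrier[OF p]
        fmat_carrier[OF \<psi>] fmat_carrier[OF \<psi>'] by auto
    then show "\<psi>' = \<psi>" by (rule faithful[OF \<psi>' \<psi>])
  qed
qed

text \<open>
  The induced endomorphism of \<open>E / B\<close> comes from the cokernel property of \<open>p\<close>, since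
  \<open>p \<phi> i = p i \<phi>\<^sub>B = 0\<close>.
\<close>

lemma ex_induced_quot:
  assumes i: "i \<in> Mor T B E" and p: "p \<in> Mor T E A" and se: "short_exact T i p"
    and \<phi>: "\<phi> \<in> Mor T E E" and \<psi>: "\<psi> \<in> Mor T B B" and eq: "\<phi> \<cdot> i = i \<cdot> \<psi>"
  shows "\<exists>\<chi> \<in> Mor T A A. \<chi> \<cdot> p = p \<cdot> \<phi>"
proof -
  have obs: "A \<in> Ob T" "B \<in> Ob T" using Mor_Ob i p by auto
  have ends: "Dom T i = B" "Cod T i = E" "Cod T p = A" using i p by (auto simp: Mor_def)
  have coker: "is_cokernel T p i" using se by (simp add: short_exact_def)
  have pi: "p \<cdot> i = Zero T B A" using coker ends by (simp add: is_cokernel_def)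
  have p\<phi>: "p \<cdot> \<phi> \<in> Mor T E A" using \<phi> p by (rule Comp_Mor)
  have mor: "(p \<cdot> \<phi>) \<cdot> i \<in> Mor T B A" using i p\<phi> by (rule Comp_Mor)
  have "(p \<cdot> \<phi>) \<cdot> i = p \<cdot> (i \<cdot> \<psi>)" using Comp_assoc[OF i \<phi> p] eq by simp
  also have "\<dots> = Zero T B A \<cdot> \<psi>" using Comp_assoc[OF \<psi> i p] pi by simp
  finally have "fmat \<omega> ((p \<cdot> \<phi>) \<cdot> i) = fmat \<omega> (Zero T B A) * fmat \<omega> \<psi>"
    using fmat_Comp[OF \<psi> Zero_Mor[OF obs(2) obs(1)]] by simp
  also have "\<dots> = fmat \<omega> (Zero T B A)"
    using fmat_Zero[OF obs(2) obs(1)] fmat_carrier[OF \<psi>] by simp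
  finally have "(p \<cdot> \<phi>) \<cdot> i = Zero T B A"
    by (rule faithful[OF mor Zero_Mor[OF obs(2) obs(1)]])
  then show ?thesis
    using coker p\<phi> obs(1) ends unfolding is_cokernel_def by blast
qed

end

section \<open>The image of \<open>\<Omega>\<close>\<close>

theorem theorem1p1:
  fixes T :: "('o, 'a, 'k::field_char_0) tensor_cat"
    and \<omega> :: "('o, 'a, 'k) fibre"
    and G :: "('k, 'h::comm_ring_1) hopf"
    and \<rho> :: "'o \<Rightarrow> 'h mat"
    and A B E :: 'o and i p :: 'a
  assumes "neutral_tannakian_cat T"
    and "tannakian_identification T \<omega> G \<rho>"
    and "A \<in> Ob T" "\<not> zero_object T A"
    and "B \<in> Ob T" "\<not> zero_object T B"
    and "i \<in> Mor T B E" "p \<in> Mor T E A" "short_exact T i p"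
    and "lie_u T \<omega> G \<rho> i p = carrier_mat (fdim \<omega> B) (fdim \<omega> A)"
  shows "Omega T i p ` End_sub T i = {(Scale T a (Id T B), Scale T a (Id T A)) | a. True}"
proof -
  note i = assms(7) and p = assms(8) and se = assms(9) and lie = assms(10)
  interpret neutral_tannakian_cat T by fact
  interpret tannakian_identification T \<omega> G \<rho> by fact
  interpret fibred_linear_cat T \<omega> by unfold_locales
  have E: "E \<in> Ob T" using Mor_Ob[OF i] by simp
  have ends: "Dom T i = B" "Cod T i = E" "Cod T p = A" using i p by (auto simp: Mor_def)
  note Mi = fmat_carrier[OF i] and Mp = fmat_carrier[OF p] and se_mat = exact[OF se]
  show ?thesis
  proof (intro equalityI subsetI)
    fix x assume "x \<in> Omega T i p ` End_sub T i"
    then obtain \<phi> \<psi> where \<phi>: "\<phi> \<in> Mor T E E" and \<psi>: "\<psi> \<in> Mor T B B"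
      and \<phi>i: "\<phi> \<cdot>\<^bsub>T\<^esub> i = i \<cdot>\<^bsub>T\<^esub> \<psi>" and x: "x = Omega T i p \<phi>"
      by (auto simp: End_sub_def ends)
    obtain \<chi> where \<chi>: "\<chi> \<in> Mor T A A" and p\<phi>: "\<chi> \<cdot>\<^bsub>T\<^esub> p = p \<cdot>\<^bsub>T\<^esub> \<phi>"
      using ex_induced_quot[OF i p se \<phi> \<psi> \<phi>i] by blast
    have Om: "x = (\<psi>, \<chi>)"
      using restrict_sub_eq[OF i se \<psi> \<phi>i[symmetric]] induced_quot_eq[OF p se \<chi> p\<phi>]
      by (simp add: x Omega_def)
    note M\<phi> = fmat_carrier[OF \<phi>] and M\<psi> = fmat_carrier[OF \<psi>] and M\<chi> = fmat_carrier[OF \<chi>]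
    have comm: "fmat \<omega> \<psi> * f = f * fmat \<omega> \<chi>"
      if f: "f \<in> carrier_mat (fdim \<omega> B) (fdim \<omega> A)" for f
    proof -
      have "f \<in> lie_u T \<omega> G \<rho> i p" using f lie by simp
      then obtain D where
        D: "D \<in> point_derivations G (image_ring G (\<rho> E)) (kernel_ideal G \<rho> A B E)"
        and Df: "map_mat D (\<rho> E) = fmat \<omega> i * f * fmat \<omega> p"
        by (auto simp: lie_u_def ends Let_def)
      have "\<rho> E \<in> carrier_mat (fdim \<omega> E) (fdim \<omega> E)"
        using rho_representation[OF E] by (simp add: representation_def)
      then have "fmat \<omega> \<phi> * map_mat D (\<rho> E) = map_mat D (\<rho> E) * fmat \<omega> \<phi>"
        using intertwiner_commutes_tangent[OF affine_group_scheme_axioms M\<phi> _ rho_natural[OF \<phi>] D]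
        by simp
      then have "fmat \<omega> \<phi> * (fmat \<omega> i * f * fmat \<omega> p) = fmat \<omega> i * f * fmat \<omega> p * fmat \<omega> \<phi>"
        by (simp add: Df)
      moreover have "fmat \<omega> \<phi> * (fmat \<omega> i * f * fmat \<omega> p) = fmat \<omega> \<phi> * fmat \<omega> i * f * fmat \<omega> p"
        using assoc_mult_mat[OF M\<phi> mult_carrier_mat[OF Mi f] Mp] assoc_mult_mat[OF M\<phi> Mi f]
        by simp
      moreover have "fmat \<omega> \<phi> * fmat \<omega> i = fmat \<omega> i * fmat \<omega> \<psi>"
        using fmat_Comp[OF i \<phi>] fmat_Comp[OF \<psi> i] \<phi>i by simp
      moreover have "fmat \<omega> i * f * fmat \<omega> p * fmat \<omega> \<phi> = fmat \<omega> i * f * (fmat \<omega> p * fmat \<omega> \<phi>)"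
        using Mi f Mp M\<phi> by (intro assoc_mult_mat) auto
      moreover have "fmat \<omega> p * fmat \<omega> \<phi> = fmat \<omega> \<chi> * fmat \<omega> p"
        using fmat_Comp[OF \<phi> p] fmat_Comp[OF p \<chi>] p\<phi> by simp
      moreover have "fmat \<omega> i * f * (fmat \<omega> \<chi> * fmat \<omega> p) = fmat \<omega> i * f * fmat \<omega> \<chi> * fmat \<omega> p"
        using Mi f Mp M\<chi> by (intro assoc_mult_mat[symmetric]) auto
      ultimately have
        "fmat \<omega> i * fmat \<omega> \<psi> * f * fmat \<omega> p = fmat \<omega> i * f * fmat \<omega> \<chi> * fmat \<omega> p" by simp
      then have "fmat \<omega> i * fmat \<omega> \<psi> * f = fmat \<omega> i * f * fmat \<omega> \<chi>"
        by (rule short_exact_mat_cancel_right[OF se_mat, rotated 2])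
          (use Mi M\<psi> f M\<chi> Mp in auto)
      then have "fmat \<omega> i * (fmat \<omega> \<psi> * f) = fmat \<omega> i * (f * fmat \<omega> \<chi>)"
        using assoc_mult_mat[OF Mi M\<psi> f] assoc_mult_mat[OF Mi f M\<chi>] by simp
      then show ?thesis
        by (rule short_exact_mat_cancel_left[OF se_mat, rotated 2])
          (use Mi M\<psi> f M\<chi> in auto)
    qed
    obtain a where a: "fmat \<omega> \<psi> = a \<cdot>\<^sub>m 1\<^sub>m (fdim \<omega> B)" "fmat \<omega> \<chi> = a \<cdot>\<^sub>m 1\<^sub>m (fdim \<omega> A)"
      using universal_intertwiners_scalar[OF M\<psi> M\<chi> fdim_pos_if_nonzero[OF assms(5,6)]
          fdim_pos_if_nonzero[OF assms(3,4)] comm] by blast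
    have "\<psi> = Scale T a (Id T B)"
      using faithful[OF \<psi> Scale_Id_Mor] fmat_Scale[OF Id_Mor] fmat_Id a(1) assms(5) by simp
    moreover have "\<chi> = Scale T a (Id T A)"
      using faithful[OF \<chi> Scale_Id_Mor] fmat_Scale[OF Id_Mor] fmat_Id a(2) assms(3) by simp
    ultimately show "x \<in> {(Scale T a (Id T B), Scale T a (Id T A)) | a. True}"
      using Om by blast
  next
    fix x assume "x \<in> {(Scale T a (Id T B), Scale T a (Id T A)) | a. True}"
    then obtain a where x: "x = (Scale T a (Id T B), Scale T a (Id T A))" by blast
    let ?\<phi> = "Scale T a (Id T E)"
    have \<phi>i: "i \<cdot>\<^bsub>T\<^esub> Scale T a (Id T B) = ?\<phi> \<cdot>\<^bsub>T\<^esub> i"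
      using Comp_Scale[OF Id_Mor i] Scale_Comp[OF i Id_Mor] Comp_Id[OF i] Id_Comp[OF i] assms(5) E
      by simp
    have p\<phi>: "Scale T a (Id T A) \<cdot>\<^bsub>T\<^esub> p = p \<cdot>\<^bsub>T\<^esub> ?\<phi>"
      using Comp_Scale[OF Id_Mor p] Scale_Comp[OF p Id_Mor] Comp_Id[OF p] Id_Comp[OF p] assms(3) E
      by simp
    have "Omega T i p ?\<phi> = x"
      using restrict_sub_eq[OF i se Scale_Id_Mor \<phi>i] induced_quot_eq[OF p se Scale_Id_Mor p\<phi>]
        assms(3,5) by (simp add: x Omega_def)
    moreover have "?\<phi> \<in> End_sub T i"
      unfolding End_sub_def ends
      using Scale_Id_Mor[OF E] Scale_Id_Mor[OF assms(5)] \<phi>i[symmetric] by blast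
    ultimately show "x \<in> Omega T i p ` End_sub T i" by blast
  qed
qed

end
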